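(* Let $(x_1,\dots,x_m)$ and $(y_1,\dots,y_m)$ be two bases of $\mathbb{R}^m$ such that (1) $x_i\cdot x_j=y_i\cdot y_j$ for all $i,j=1,\dots,m$, and (2) $x_1\wedge\cdots\wedge x_m=y_1\wedge\cdots\wedge y_m$. Then one can construct a rotor $R$ in the geometric algebra $\mathbb{G}_m$ (in particular, there exists a rotor $R$) such that $R\,x_i\,\tilde R=y_i$ for all $i=1,\dots,m$.
   Context: $\mathbb{R}^m$ carries the standard Euclidean inner product, denoted $\cdot$. $\mathbb{G}_m$ is the real geometric (Clifford) algebra of this positive definite form: the associative unital algebra on the vector space $\Lambda(\mathbb{R}^m)$ generated by $\mathbb{R}^m$, in which the geometric product of vectors is $uv=u\cdot v+u\wedge v$ (so $v^2=v\cdot v$). $\wedge$ is the outer (Grassmann) product. $\tilde{\ }$ denotes reversal, the linear anti-automorphism with $\widetilde{v_1v_2\cdots v_k}=v_k\cdots v_2v_1$ for vectors $v_i$. A rotor is a geometric product of an even number of unit vectors (so $R\tilde R=1$); it acts on vectors by the rotation $v\mapsto Rv\tilde R$. *)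

theory Defs
  imports "HOL-Analysis.Analysis"
begin

text \<open>
  The algebra is built on the exterior algebra of \<^typ>\<open>real ^ 'n\<close>. A multivector is given by its
  coordinates with respect to the basis blades \<open>e\<^sub>A = e\<^sub>i \<and> \<dots> \<and> e\<^sub>j\<close>, where \<open>A = {i < \<dots> < j}\<close> ranges
  over the subsets of \<^typ>\<open>'n\<close> and \<open>e\<^sub>i = axis i 1\<close> is the standard orthonormal basis. The linear
  order on \<^typ>\<open>'n\<close> only serves to fix the signs of the basis blades.
\<close>

typedef 'n multivector = "UNIV :: ('n set \<Rightarrow> real) set"
  morphisms coeff Multivector
  by simp

setup_lifting type_definition_multivector

lemma multivector_eqI: "(\<And>A. coeff X A = coeff Y A) \<Longrightarrow> X = Y"
  by (simp add: coeff_inject[symmetric] fun_eq_iff)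

instantiation multivector :: (type) real_vector
begin

lift_definition zero_multivector :: "'a multivector" is "\<lambda>_. 0" .
lift_definition plus_multivector :: "'a multivector \<Rightarrow> 'a multivector \<Rightarrow> 'a multivector"
  is "\<lambda>X Y A. X A + Y A" .
lift_definition minus_multivector :: "'a multivector \<Rightarrow> 'a multivector \<Rightarrow> 'a multivector"
  is "\<lambda>X Y A. X A - Y A" .
lift_definition uminus_multivector :: "'a multivector \<Rightarrow> 'a multivector" is "\<lambda>X A. - X A" .
lift_definition scaleR_multivector :: "real \<Rightarrow> 'a multivector \<Rightarrow> 'a multivector"
  is "\<lambda>r X A. r * X A" .

instance
  by standard (transfer, simp add: fun_eq_iff algebra_simps)+

end

lemma coeff_simps [simp]:
  "coeff 0 A = 0"
  "coeff (X + Y) A = coeff X A + coeff Y A"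
  "coeff (X - Y) A = coeff X A - coeff Y A"
  "coeff (- X) A = - coeff X A"
  "coeff (r *\<^sub>R X) A = r * coeff X A"
  by (transfer, simp)+

lemma coeff_sum: "coeff (sum f S) A = (\<Sum>x\<in>S. coeff (f x) A)"
  by (induction S rule: infinite_finite_induct) auto

text \<open>
  Sorting the concatenation of the increasing lists of \<open>A\<close> and \<open>B\<close> takes one transposition of
  anticommuting vectors for each pair \<open>a \<in> A\<close>, \<open>b \<in> B\<close> with \<open>b < a\<close>; in the geometric product the
  repeated vectors then cancel since \<open>e\<^sub>i e\<^sub>i = 1\<close>, so that \<open>e\<^sub>A e\<^sub>B = \<plusminus> e\<^sub>C\<close> with \<open>C\<close> the symmetric
  difference of \<open>A\<close> and \<open>B\<close>.
\<close>

definition reorder_sign :: "'n::linorder set \<Rightarrow> 'n set \<Rightarrow> real" where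
  "reorder_sign A B = (\<Prod>a\<in>A. \<Prod>b\<in>B. if b < a then - 1 else 1)"

lemma reorder_sign_simps [simp]: "reorder_sign {} B = 1" "reorder_sign A {} = 1"
  by (simp_all add: reorder_sign_def)

lemma prod_sym_diff:
  fixes f :: "'a \<Rightarrow> real"
  assumes "finite A" "finite B" "\<And>x. f x * f x = 1"
  shows "prod f (sym_diff A B) = prod f A * prod f B"
proof -
  have "prod f A = prod f (A - B) * prod f (A \<inter> B)"
    using prod.Int_Diff[OF assms(1), of f B] by (simp add: mult.commute)
  moreover have "prod f B = prod f (B - A) * prod f (A \<inter> B)"
    using prod.Int_Diff[OF assms(2), of f A] by (simp add: mult.commute Int_commute)
  moreover have "prod f (A \<inter> B) * prod f (A \<inter> B) = 1"
    by (simp add: prod.distrib[symmetric] assms(3))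
  moreover have "prod f (sym_diff A B) = prod f (A - B) * prod f (B - A)"
    using assms by (intro prod.union_disjoint) auto
  ultimately show ?thesis by (simp add: algebra_simps)
qed

lemma reorder_sign_square: "reorder_sign A B * reorder_sign A B = 1"
  unfolding reorder_sign_def prod.distrib[symmetric] by (intro prod.neutral ballI) auto

lemma reorder_sign_sym_diff:
  fixes A B C :: "'n::{finite,linorder} set"
  shows "reorder_sign (sym_diff A B) C = reorder_sign A C * reorder_sign B C"
    and "reorder_sign C (sym_diff A B) = reorder_sign C A * reorder_sign C B"
proof -
  have 1: "(\<Prod>b\<in>C. if b < a then - 1 else 1) * (\<Prod>b\<in>C. if b < a then - 1 else 1) = (1::real)" for a
    unfolding prod.distrib[symmetric] by (intro prod.neutral) auto
  show "reorder_sign (sym_diff A B) C = reorder_sign A C * reorder_sign B C"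
    unfolding reorder_sign_def by (rule prod_sym_diff) (use 1 in auto)
  have "(\<Prod>b\<in>sym_diff A B. if b < a then - 1 else 1) =
    (\<Prod>b\<in>A. if b < a then - 1 else 1) * (\<Prod>b\<in>B. if b < a then - 1 else (1::real))" for a
    by (rule prod_sym_diff) auto
  then show "reorder_sign C (sym_diff A B) = reorder_sign C A * reorder_sign C B"
    unfolding reorder_sign_def prod.distrib[symmetric] by simp
qed

lift_definition geometric_product ::
    "'n::{finite,linorder} multivector \<Rightarrow> 'n multivector \<Rightarrow> 'n multivector"
  is "\<lambda>X Y C. \<Sum>(A, B) | sym_diff A B = C. reorder_sign A B * X A * Y B" .

lift_definition outer_product ::
    "'n::{finite,linorder} multivector \<Rightarrow> 'n multivector \<Rightarrow> 'n multivector"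
    (infixr \<open>\<^bold>\<and>\<close> 70)
  is "\<lambda>X Y C. \<Sum>(A, B) | A \<inter> B = {} \<and> A \<union> B = C. reorder_sign A B * X A * Y B" .

lemma coeff_geometric_product:
  "coeff (geometric_product X Y) C =
    (\<Sum>A\<in>UNIV. reorder_sign A (sym_diff A C) * coeff X A * coeff Y (sym_diff A C))"
proof -
  have "{(A, B). sym_diff A B = C} = (\<lambda>A. (A, sym_diff A C)) ` UNIV"
  proof (intro equalityI subsetI)
    fix p assume "p \<in> {(A, B). sym_diff A B = C}"
    moreover have "B = sym_diff A (sym_diff A B)" for A B :: "'a set" by blast
    ultimately show "p \<in> (\<lambda>A. (A, sym_diff A C)) ` UNIV" by auto
  qed auto
  then show ?thesis
    by (simp add: geometric_product.rep_eq sum.reindex inj_on_def)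
qed

lemma geometric_product_assoc:
  "geometric_product (geometric_product X Y) Z = geometric_product X (geometric_product Y Z)"
proof (rule multivector_eqI)
  fix D :: "'a set"
  let ?s = "reorder_sign :: 'a set \<Rightarrow> _" and ?d = "sym_diff :: 'a set \<Rightarrow> 'a set \<Rightarrow> 'a set"
  let ?t = "\<lambda>A B. ?s A B * ?s A (?d (?d A B) D) * ?s B (?d (?d A B) D) *
                   coeff X A * coeff Y B * coeff Z (?d (?d A B) D)"
  have a: "?d B (?d A D) = ?d (?d A B) D" for A B by blast
  have b: "?d A D = ?d B (?d (?d A B) D)" for A B by blast
  have "coeff (geometric_product (geometric_product X Y) Z) D =
    (\<Sum>A\<in>UNIV. \<Sum>E\<in>UNIV. ?s E (?d E D) * (?s A (?d A E) * coeff X A * coeff Y (?d A E)) * coeff Z (?d E D))"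
    unfolding coeff_geometric_product sum_distrib_left sum_distrib_right by (rule sum.swap)
  also have "\<dots> = (\<Sum>A\<in>UNIV. \<Sum>B\<in>UNIV. ?t A B)"
  proof (rule sum.cong[OF refl])
    fix A
    show "(\<Sum>E\<in>UNIV. ?s E (?d E D) * (?s A (?d A E) * coeff X A * coeff Y (?d A E)) * coeff Z (?d E D))
      = (\<Sum>B\<in>UNIV. ?t A B)"
    proof (rule sum.reindex_bij_witness[where i = "?d A" and j = "?d A"])
      fix E :: "'a set"
      have e: "?d A (?d A E) = E" by blast
      show "?t A (?d A E) =
        ?s E (?d E D) * (?s A (?d A E) * coeff X A * coeff Y (?d A E)) * coeff Z (?d E D)"
        using reorder_sign_sym_diff(1)[of A "?d A E" "?d E D"] unfolding e by simp
    qed auto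
  qed
  also have "\<dots> = coeff (geometric_product X (geometric_product Y Z)) D"
    unfolding coeff_geometric_product sum_distrib_left sum_distrib_right
  proof (intro sum.cong refl)
    fix A B :: "'a set"
    show "?t A B = ?s A (?d A D) * coeff X A *
          (?s B (?d B (?d A D)) * coeff Y B * coeff Z (?d B (?d A D)))"
      using reorder_sign_sym_diff(2)[of A B "?d (?d A B) D"] b[of A B] a[of B A]
      by simp
  qed
  finally show "coeff (geometric_product (geometric_product X Y) Z) D =
    coeff (geometric_product X (geometric_product Y Z)) D" .
qed

instantiation multivector :: ("{finite,linorder}") real_algebra_1
begin

definition "times_multivector = (geometric_product :: 'a multivector \<Rightarrow> _)"

lift_definition one_multivector :: "'a multivector" is "\<lambda>A. if A = {} then 1 else 0" .

instance
proof
  fix X Y Z :: "'a multivector" and r :: real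
  show "X * Y * Z = X * (Y * Z)"
    by (simp add: times_multivector_def geometric_product_assoc)
  show "(X + Y) * Z = X * Z + Y * Z" "X * (Y + Z) = X * Y + X * Z"
    "r *\<^sub>R X * Y = r *\<^sub>R (X * Y)" "X * r *\<^sub>R Y = r *\<^sub>R (X * Y)"
    by (auto intro!: multivector_eqI
        simp: times_multivector_def coeff_geometric_product sum_distrib_left
          sum.distrib[symmetric] algebra_simps)
  have eq: "A \<subseteq> C \<and> C \<subseteq> A \<longleftrightarrow> A = C" for A C :: "'a set" by blast
  show "1 * X = X"
    by (rule multivector_eqI) (simp add: times_multivector_def coeff_geometric_product
        one_multivector.rep_eq if_distrib if_distribR cong: if_cong)
  show "X * 1 = X"
    by (rule multivector_eqI) (simp add: times_multivector_def coeff_geometric_product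
        one_multivector.rep_eq eq if_distrib if_distribR cong: if_cong)
  show "(0::'a multivector) \<noteq> 1"
    by (metis coeff_simps(1) one_multivector.rep_eq zero_neq_one)
qed

end

lift_definition of_vector :: "real ^ 'n \<Rightarrow> 'n::finite multivector"
  is "\<lambda>v A. \<Sum>i | A = {i}. v $ i" .

text \<open>Reversing a product of \<open>k\<close> anticommuting vectors takes \<open>k choose 2\<close> transpositions.\<close>

lift_definition reversal :: "'n multivector \<Rightarrow> 'n multivector"
  is "\<lambda>X A. (- 1) ^ (card A choose 2) * X A" .

definition outer_list :: "'n::{finite,linorder} multivector list \<Rightarrow> 'n multivector" where
  "outer_list Xs = foldr (\<^bold>\<and>) Xs 1"

definition rotor :: "'n::{finite,linorder} multivector \<Rightarrow> bool" where
  "rotor R \<longleftrightarrow> (\<exists>us. even (length us) \<and> (\<forall>u\<in>set us. norm u = 1) \<and>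
     R = prod_list (map of_vector us))"

definition is_basis :: "(nat \<Rightarrow> 'a::euclidean_space) \<Rightarrow> bool" where
  "is_basis x \<longleftrightarrow> inj_on x {1..DIM('a)} \<and> independent (x ` {1..DIM('a)}) \<and>
     span (x ` {1..DIM('a)}) = UNIV"

text \<open>
  Dimension \<open>2 ^ CARD('n)\<close>, generation by vectors and \<open>v v = v \<bullet> v\<close> determine the Clifford algebra up
  to isomorphism, so \<open>of_vector_square\<close>, \<open>blade_expansion\<close> and \<open>vectors_generate\<close> below show that the
  coordinate construction is the intended algebra.
\<close>

lift_definition blade :: "'n set \<Rightarrow> 'n multivector" is "\<lambda>A B. if B = A then 1 else 0" .

lemma blade_empty: "blade {} = 1"
  by (rule multivector_eqI) (simp add: blade.rep_eq one_multivector.rep_eq)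

lemma blade_expansion: "X = (\<Sum>A\<in>UNIV. coeff X A *\<^sub>R blade A)" for X :: "'n::finite multivector"
  by (rule multivector_eqI) (simp add: coeff_sum blade.rep_eq if_distrib cong: if_cong)

lemma linear_eq_on_blades:
  fixes f g :: "'n::finite multivector \<Rightarrow> 'b::real_vector"
  assumes "linear f" "linear g" "\<And>A. f (blade A) = g (blade A)"
  shows "f X = g X"
  by (subst (1 2) blade_expansion[of X])
    (simp add: linear_sum[OF assms(1)] linear_sum[OF assms(2)]
      linear_scale[OF assms(1)] linear_scale[OF assms(2)] assms(3))

lemma blade_times:
  "blade A * blade B = reorder_sign A B *\<^sub>R blade (sym_diff A B)"
proof (rule multivector_eqI)
  fix C
  have "coeff (blade A * blade B) C =
    (\<Sum>A'\<in>UNIV. if A' = A then if sym_diff A C = B then reorder_sign A B else 0 else 0)"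
    unfolding times_multivector_def coeff_geometric_product blade.rep_eq by (intro sum.cong) auto
  also have "sym_diff A C = B \<longleftrightarrow> C = sym_diff A B" by blast
  finally show "coeff (blade A * blade B) C = coeff (reorder_sign A B *\<^sub>R blade (sym_diff A B)) C"
    by (simp add: blade.rep_eq)
qed

lemma coeff_outer_product:
  "coeff (X \<^bold>\<and> Y) C = (\<Sum>A\<in>UNIV. \<Sum>B\<in>UNIV.
     if A \<inter> B = {} \<and> A \<union> B = C then reorder_sign A B * coeff X A * coeff Y B else 0)"
proof -
  have "coeff (X \<^bold>\<and> Y) C = (\<Sum>p\<in>UNIV. if p \<in> {(A, B). A \<inter> B = {} \<and> A \<union> B = C}
      then (case p of (A, B) \<Rightarrow> reorder_sign A B * coeff X A * coeff Y B) else 0)"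
    unfolding outer_product.rep_eq by (subst sum.inter_restrict[symmetric]) auto
  also have "\<dots> = (\<Sum>p\<in>UNIV \<times> UNIV. case p of (A, B) \<Rightarrow> if A \<inter> B = {} \<and> A \<union> B = C
      then reorder_sign A B * coeff X A * coeff Y B else 0)"
    unfolding UNIV_Times_UNIV by (intro sum.cong) (simp_all add: case_prod_beta)
  finally show ?thesis by (simp add: sum.cartesian_product)
qed

lemma blade_outer:
  "blade A \<^bold>\<and> blade B = (if A \<inter> B = {} then reorder_sign A B *\<^sub>R blade (A \<union> B) else 0)"
proof (rule multivector_eqI)
  fix C
  have "coeff (blade A \<^bold>\<and> blade B) C =
    (\<Sum>A'\<in>UNIV. \<Sum>B'\<in>UNIV. if B' = B then if A' = A then
       if A \<inter> B = {} \<and> A \<union> B = C then reorder_sign A B else 0 else 0 else 0)"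
    unfolding coeff_outer_product blade.rep_eq by (intro sum.cong refl) auto
  then show "coeff (blade A \<^bold>\<and> blade B) C =
    coeff (if A \<inter> B = {} then reorder_sign A B *\<^sub>R blade (A \<union> B) else 0) C"
    by (auto simp: blade.rep_eq)
qed

lemma bilinear_outer: "bilinear (\<^bold>\<and>)"
  unfolding bilinear_def
proof (intro conjI allI linearI multivector_eqI)
  fix X Y Z :: "'a multivector" and r :: real and C
  show "coeff (X \<^bold>\<and> (Y + Z)) C = coeff (X \<^bold>\<and> Y + X \<^bold>\<and> Z) C"
    "coeff ((Y + Z) \<^bold>\<and> X) C = coeff (Y \<^bold>\<and> X + Z \<^bold>\<and> X) C"
    unfolding coeff_outer_product coeff_simps sum.distrib[symmetric]
    by (intro sum.cong refl, simp add: algebra_simps)+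
  show "coeff (X \<^bold>\<and> r *\<^sub>R Y) C = coeff (r *\<^sub>R (X \<^bold>\<and> Y)) C"
    "coeff (r *\<^sub>R Y \<^bold>\<and> X) C = coeff (r *\<^sub>R (Y \<^bold>\<and> X)) C"
    unfolding coeff_outer_product coeff_simps sum_distrib_left
    by (intro sum.cong refl, simp)+
qed

lemma linear_outer_left: "linear (\<lambda>X. X \<^bold>\<and> Y)"
  and linear_outer_right: "linear (\<lambda>Y. X \<^bold>\<and> Y)"
  using bilinear_outer by (auto simp: bilinear_def)

lemma outer_assoc: "(X \<^bold>\<and> Y) \<^bold>\<and> Z = X \<^bold>\<and> (Y \<^bold>\<and> Z)"
proof -
  note lin = linear_outer_left linear_outer_right linear_compose[OF linear_outer_left linear_outer_left, unfolded o_def]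
    linear_compose[OF linear_outer_right linear_outer_right, unfolded o_def]
    linear_compose[OF linear_outer_right linear_outer_left, unfolded o_def]
    linear_compose[OF linear_outer_left linear_outer_right, unfolded o_def]
  have union: "reorder_sign (A \<union> B) C = reorder_sign A C * reorder_sign B C"
    "reorder_sign C (A \<union> B) = reorder_sign C A * reorder_sign C B"
    if "A \<inter> B = {}" for A B C :: "'a set"
  proof -
    have "A \<union> B = sym_diff A B" using that by blast
    then show "reorder_sign (A \<union> B) C = reorder_sign A C * reorder_sign B C"
      "reorder_sign C (A \<union> B) = reorder_sign C A * reorder_sign C B"
      using reorder_sign_sym_diff[where A = A and B = B and C = C] by simp_all
  qed
  have 1: "(blade A \<^bold>\<and> blade B) \<^bold>\<and> blade C = blade A \<^bold>\<and> (blade B \<^bold>\<and> blade C)" for A B C :: "'a set"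
    by (auto simp: blade_outer linear_scale[OF linear_outer_left] linear_scale[OF linear_outer_right]
        linear_0[OF linear_outer_left] linear_0[OF linear_outer_right] Int_Un_distrib Int_Un_distrib2
        union Un_assoc)
  have 2: "(blade A \<^bold>\<and> blade B) \<^bold>\<and> Z = blade A \<^bold>\<and> (blade B \<^bold>\<and> Z)" for A B
    by (rule linear_eq_on_blades[OF lin(2) lin(4)]) (rule 1)
  have 3: "(blade A \<^bold>\<and> Y) \<^bold>\<and> Z = blade A \<^bold>\<and> (Y \<^bold>\<and> Z)" for A
    by (rule linear_eq_on_blades[OF lin(5) lin(6)]) (rule 2)
  show ?thesis
    by (rule linear_eq_on_blades[OF lin(3) lin(1)]) (rule 3)
qed

lemma outer_one [simp]: "1 \<^bold>\<and> X = X" "X \<^bold>\<and> 1 = X"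
  by (rule linear_eq_on_blades[OF linear_outer_right linear_ident] linear_eq_on_blades[OF linear_outer_left linear_ident],
      simp add: blade_empty[symmetric] blade_outer)+

lemma linear_of_vector: "linear of_vector"
  by (auto intro!: linearI multivector_eqI simp: of_vector.rep_eq sum.distrib sum_distrib_left)

lemma coeff_of_vector: "coeff (of_vector v) {i} = v $ i"
proof -
  have "{j. {i} = {j}} = {i}" by auto
  then show ?thesis by (simp add: of_vector.rep_eq)
qed

lemma inj_of_vector: "inj of_vector"
  by (rule injI) (metis coeff_of_vector vec_eq_iff)

lemma of_vector_axis: "of_vector (axis i 1) = blade {i}"
proof (rule multivector_eqI)
  fix A
  have "(\<Sum>j | A = {j}. axis i (1::real) $ j) = (\<Sum>j | A = {j} \<and> j = i. 1)"
    by (rule sum.mono_neutral_cong_right) (auto simp: axis_def)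
  also have "{j. A = {j} \<and> j = i} = (if A = {i} then {i} else {})" by auto
  finally show "coeff (of_vector (axis i 1)) A = coeff (blade {i}) A"
    by (simp add: of_vector.rep_eq blade.rep_eq)
qed

lemma of_vector_expansion: "of_vector v = (\<Sum>i\<in>UNIV. v $ i *\<^sub>R blade {i})"
proof -
  have "of_vector v = of_vector (\<Sum>i\<in>UNIV. v $ i *\<^sub>R axis i 1)"
    by (simp add: basis_expansion scalar_mult_eq_scaleR[symmetric])
  then show ?thesis
    by (simp add: linear_sum[OF linear_of_vector] linear_scale[OF linear_of_vector] of_vector_axis)
qed

lemma outer_of_vector_expansion:
  "of_vector u \<^bold>\<and> of_vector v = (\<Sum>i\<in>UNIV. \<Sum>j\<in>UNIV. (u $ i * v $ j) *\<^sub>R (blade {i} \<^bold>\<and> blade {j}))"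
proof -
  have "of_vector u \<^bold>\<and> of_vector v = (\<Sum>j\<in>UNIV. \<Sum>i\<in>UNIV. (u $ i * v $ j) *\<^sub>R (blade {i} \<^bold>\<and> blade {j}))"
    unfolding of_vector_expansion
    by (simp add: linear_sum[OF linear_outer_left] linear_sum[OF linear_outer_right]
        linear_scale[OF linear_outer_left] linear_scale[OF linear_outer_right]
        scaleR_sum_right mult.commute)
  then show ?thesis by (subst sum.swap)
qed

theorem of_vector_times:
  "of_vector u * of_vector v = (u \<bullet> v) *\<^sub>R 1 + of_vector u \<^bold>\<and> of_vector v"
proof -
  have b: "blade {i} * blade {j} = (if i = j then 1 else 0) + blade {i} \<^bold>\<and> blade {j}" for i j :: 'a
    by (auto simp: blade_times blade_outer blade_empty insert_commute reorder_sign_def insert_Diff_if)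
  have "of_vector u * of_vector v =
      (\<Sum>i\<in>UNIV. \<Sum>j\<in>UNIV. (u $ i * v $ j) *\<^sub>R (blade {i} * blade {j}))"
    unfolding of_vector_expansion by (simp add: sum_product mult.commute)
  also have "\<dots> = (\<Sum>i\<in>UNIV. \<Sum>j\<in>UNIV. if i = j then (u $ i * v $ j) *\<^sub>R 1 else 0) +
      (\<Sum>i\<in>UNIV. \<Sum>j\<in>UNIV. (u $ i * v $ j) *\<^sub>R (blade {i} \<^bold>\<and> blade {j}))"
    unfolding sum.distrib[symmetric] by (intro sum.cong refl) (simp add: b scaleR_right_distrib)
  also have "(\<Sum>i\<in>UNIV. \<Sum>j\<in>UNIV. if i = j then (u $ i * v $ j) *\<^sub>R 1 else 0) =
      (u \<bullet> v) *\<^sub>R (1 :: 'a multivector)"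
    by (simp add: inner_vec_def scaleR_sum_left)
  finally show ?thesis by (simp only: outer_of_vector_expansion)
qed

lemma outer_of_vector_commute: "of_vector u \<^bold>\<and> of_vector v = - (of_vector v \<^bold>\<and> of_vector u)"
proof -
  have b: "blade {i} \<^bold>\<and> blade {j} = - (blade {j} \<^bold>\<and> blade {i})" for i j :: 'a
    by (cases i j rule: linorder_cases) (auto simp: blade_outer reorder_sign_def insert_commute)
  have "of_vector u \<^bold>\<and> of_vector v = (\<Sum>j\<in>UNIV. \<Sum>i\<in>UNIV. (u $ i * v $ j) *\<^sub>R (blade {i} \<^bold>\<and> blade {j}))"
    unfolding outer_of_vector_expansion by (rule sum.swap)
  also have "\<dots> = (\<Sum>j\<in>UNIV. \<Sum>i\<in>UNIV. - ((v $ j * u $ i) *\<^sub>R (blade {j} \<^bold>\<and> blade {i})))"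
    by (intro sum.cong refl) (subst b, simp add: mult.commute)
  finally show ?thesis
    unfolding outer_of_vector_expansion[of v u] by (simp add: sum_negf)
qed

lemma outer_of_vector_self: "of_vector v \<^bold>\<and> of_vector v = 0"
proof -
  have "2 *\<^sub>R (of_vector v \<^bold>\<and> of_vector v) = 0"
    using outer_of_vector_commute[of v v] by (simp add: scaleR_2 eq_neg_iff_add_eq_0)
  then show ?thesis by simp
qed

corollary of_vector_square: "of_vector v * of_vector v = (v \<bullet> v) *\<^sub>R 1"
  by (simp add: of_vector_times outer_of_vector_self)

lemma blade_products:
  assumes "sorted is" "distinct is"
  shows "prod_list (map (\<lambda>i. of_vector (axis i 1)) is) = blade (set is)"
    and "outer_list (map (\<lambda>i. of_vector (axis i 1)) is) = blade (set is)"
proof -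
  have "prod_list (map (\<lambda>i. of_vector (axis i 1)) is) = blade (set is) \<and>
        outer_list (map (\<lambda>i. of_vector (axis i 1)) is) = blade (set is)"
    using assms
  proof (induction "is")
    case Nil
    then show ?case by (simp add: outer_list_def blade_empty)
  next
    case (Cons i "is")
    have "reorder_sign {i} (set is) = 1"
      unfolding reorder_sign_def using Cons.prems by (auto intro!: prod.neutral)
    moreover have "sym_diff {i} (set is) = insert i (set is)"
      using Cons.prems by auto
    ultimately show ?case
      using Cons by (simp add: outer_list_def of_vector_axis blade_times blade_outer)
  qed
  then show "prod_list (map (\<lambda>i. of_vector (axis i 1)) is) = blade (set is)"
    and "outer_list (map (\<lambda>i. of_vector (axis i 1)) is) = blade (set is)"
    by auto
qed

theorem vectors_generate:
  "span (range (\<lambda>us. prod_list (map of_vector us))) = (UNIV :: 'n::{finite,linorder} multivector set)"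
proof -
  let ?S = "range (\<lambda>us. prod_list (map of_vector us)) :: 'n multivector set"
  have "blade A \<in> ?S" for A :: "'n set"
  proof -
    have "blade A = prod_list (map of_vector (map (\<lambda>i. axis i 1) (sorted_list_of_set A)))"
      using blade_products(1)[of "sorted_list_of_set A"] by (simp add: o_def)
    then show ?thesis by blast
  qed
  then have "(\<Sum>A\<in>UNIV. coeff X A *\<^sub>R blade A) \<in> span ?S" for X :: "'n multivector"
    by (intro span_sum span_scale span_base)
  then show ?thesis
    using blade_expansion by (metis UNIV_eq_I)
qed

lemma reorder_sign_self:
  fixes A :: "'n::{finite,linorder} set"
  shows "reorder_sign A A = (- 1) ^ (card A choose 2)"
  using finite[of A]
proof (induction A rule: finite_linorder_max_induct)
  case empty
  then show ?case by (simp add: binomial_eq_0)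
next
  case (insert b A)
  have "b \<notin> A" using insert by auto
  then have i: "insert b A = sym_diff {b} A" by auto
  have "reorder_sign {b} A = (- 1) ^ card A"
    using insert by (simp add: reorder_sign_def)
  moreover have "reorder_sign A {b} = 1"
    using insert by (auto simp: reorder_sign_def intro!: prod.neutral)
  moreover have "reorder_sign {b} {b} = 1"
    by (simp add: reorder_sign_def)
  ultimately have "reorder_sign (insert b A) (insert b A) = (- 1) ^ card A * (- 1) ^ (card A choose 2)"
    unfolding i reorder_sign_sym_diff insert.IH by simp
  also have "\<dots> = (- 1) ^ (card (insert b A) choose 2)"
    using \<open>b \<notin> A\<close> by (simp add: numeral_2_eq_2 power_add)
  finally show ?case .
qed

lemma linear_reversal: "linear reversal"
  by (auto intro!: linearI multivector_eqI simp: reversal.rep_eq algebra_simps)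

lemma reversal_blade: "reversal (blade A) = reorder_sign A A *\<^sub>R blade A"
  for A :: "'n::{finite,linorder} set"
  by (rule multivector_eqI) (simp add: reversal.rep_eq blade.rep_eq reorder_sign_self)

lemma reversal_one [simp]: "reversal 1 = 1"
  by (simp add: blade_empty[symmetric] reversal_blade)

lemma reversal_of_vector [simp]: "reversal (of_vector v) = of_vector v"
  for v :: "real ^ 'n::{finite,linorder}"
  by (simp add: of_vector_expansion linear_sum[OF linear_reversal] linear_scale[OF linear_reversal]
      reversal_blade, simp add: reorder_sign_def)

lemma reversal_times: "reversal (X * Y) = reversal Y * reversal X"
  for X Y :: "'n::{finite,linorder} multivector"
proof -
  note lin = linear_reversal linear_compose[OF _ linear_reversal, unfolded o_def]
  have l: "linear (\<lambda>X :: 'n multivector. X * Z)" "linear (\<lambda>X :: 'n multivector. Z * X)"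
    for Z :: "'n multivector"
    by (auto intro!: linearI simp: algebra_simps)
  have 1: "reversal (blade A * blade B) = reversal (blade B) * reversal (blade A)" for A B :: "'n set"
  proof -
    have "sym_diff B A = sym_diff A B" by blast
    then show ?thesis
      using reorder_sign_square[of A B]
      by (simp add: blade_times linear_scale[OF linear_reversal] reversal_blade
          reorder_sign_sym_diff mult_ac)
  qed
  have 2: "reversal (blade A * Y) = reversal Y * reversal (blade A)" for A
    by (rule linear_eq_on_blades[OF lin(2)[OF l(2)] linear_compose[OF lin(1) l(1), unfolded o_def]])
      (rule 1)
  show ?thesis
    by (rule linear_eq_on_blades[OF lin(2)[OF l(1)] linear_compose[OF lin(1) l(2), unfolded o_def]])
      (rule 2)
qed

lemma reversal_prod_list:
  "reversal (prod_list (map of_vector us)) = prod_list (map of_vector (rev us))"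
  by (induction us) (simp_all add: reversal_times)

theorem reversal_unique:
  fixes f :: "'n::{finite,linorder} multivector \<Rightarrow> 'n multivector"
  shows "linear f \<and> (\<forall>us. f (prod_list (map of_vector us)) = prod_list (map of_vector (rev us)))
    \<longleftrightarrow> f = reversal"
proof
  assume f: "linear f \<and> (\<forall>us. f (prod_list (map of_vector us)) = prod_list (map of_vector (rev us)))"
  show "f = reversal"
  proof
    fix X
    show "f X = reversal X"
      by (rule linear_eq_on[where f = f and g = reversal and B = "range (\<lambda>us. prod_list (map of_vector us))"])
        (use f linear_reversal in \<open>auto simp: vectors_generate reversal_prod_list\<close>)
  qed
qed (auto simp: linear_reversal reversal_prod_list)

lemma rotor_reversal:
  fixes R :: "'n::{finite,linorder} multivector"
  assumes "rotor R"
  shows "R * reversal R = 1"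
proof -
  have "prod_list (map of_vector us) * reversal (prod_list (map of_vector us)) = 1"
    if "\<forall>u\<in>set us. norm u = 1" for us :: "(real, 'n) vec list"
    using that
  proof (induction us rule: rev_induct)
    case (snoc u us)
    have "of_vector u * of_vector u = 1"
      using snoc.prems by (simp add: of_vector_square norm_eq_1)
    then have "of_vector u * (of_vector u * Z) = Z" for Z
      by (metis mult.assoc mult_1)
    then show ?case
      using snoc by (simp add: reversal_times mult.assoc)
  qed simp
  then show ?thesis
    using assms by (auto simp: rotor_def)
qed

end

theory Submission
  imports Defs
begin

text \<open>
  As in the Cartan--Dieudonne theorem, the vectors \<open>x\<^sub>1, \<dots>, x\<^sub>m\<close> are moved to \<open>y\<^sub>1, \<dots>, y\<^sub>m\<close> one after
  the other: a reflection along \<open>f x\<^sub>k - y\<^sub>k\<close> corrects the \<open>k\<close>-th image and fixes \<open>y\<^sub>i\<close> for \<open>i < k\<close>,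
  because it is orthogonal to them by equality of the Gram matrices. Let \<open>P\<close> be the product of the
  unit normals. If their number is odd, then \<open>P x\<^sub>i P\<^sup>~ = - y\<^sub>i\<close>, so that \<open>P X P\<^sup>~ = (-1)\<^sup>m X\<close> for
  \<open>X = x\<^sub>1 \<and> \<dots> \<and> x\<^sub>m = y\<^sub>1 \<and> \<dots> \<and> y\<^sub>m\<close>. But \<open>v \<and> X = 0\<close> for every vector \<open>v\<close>, which says that
  \<open>v X = (-1)\<^sup>m\<^sup>-\<^sup>1 X v\<close>, so that also \<open>P X P\<^sup>~ = (-1)\<^sup>m\<^sup>-\<^sup>1 X\<close>. Hence \<open>X = 0\<close>, contradicting the
  independence of the \<open>x\<^sub>i\<close>. The bridge between the two products is
  \<open>2 (v \<and> X) = v X + X' v\<close>, where \<open>X'\<close> is the grade involution of \<open>X\<close>.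
\<close>

section \<open>Grade involution, linking the outer and the geometric product\<close>

lift_definition grade_involution :: "'n multivector \<Rightarrow> 'n multivector"
  is "\<lambda>X A. (- 1) ^ card A * X A" .

lemma linear_grade_involution: "linear grade_involution"
  by (auto intro!: linearI multivector_eqI simp: grade_involution.rep_eq algebra_simps)

lemma grade_involution_blade: "grade_involution (blade A) = (- 1) ^ card A *\<^sub>R blade A"
  by (rule multivector_eqI) (simp add: grade_involution.rep_eq blade.rep_eq)

lemma grade_involution_one [simp]: "grade_involution 1 = 1"
  by (simp add: blade_empty[symmetric] grade_involution_blade)

lemma grade_involution_of_vector [simp]:
  "grade_involution (of_vector v) = - of_vector v" for v :: "real ^ 'n::finite"
  by (simp add: of_vector_expansion linear_sum[OF linear_grade_involution]
      linear_scale[OF linear_grade_involution] grade_involution_blade sum_negf)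

lemma grade_involution_involutive [simp]: "grade_involution (grade_involution X) = X"
  by (rule multivector_eqI) (simp add: grade_involution.rep_eq minus_one_power_iff)

lemma linear_times_left: "linear (\<lambda>X :: 'a::real_algebra. X * Z)"
  and linear_times_right: "linear (\<lambda>X :: 'a::real_algebra. Z * X)"
  by (auto intro!: linearI simp: algebra_simps)

text \<open>The cardinality of a symmetric difference has the parity of the sum of the two
  cardinalities, which settles basis blades; linearity in each factor does the rest.\<close>

lemma grade_involution_times:
  "grade_involution (X * Y) = grade_involution X * grade_involution Y"
  for X Y :: "'n::{finite,linorder} multivector"
proof -
  note lin = linear_compose[OF _ linear_grade_involution, unfolded o_def]
    linear_compose[OF linear_grade_involution, unfolded o_def]
  have 1: "grade_involution (blade A * blade B) = grade_involution (blade A) * grade_involution (blade B)"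
    for A B :: "'n set"
    using prod_sym_diff[of A B "\<lambda>_. - 1"]
    by (simp add: blade_times linear_scale[OF linear_grade_involution] grade_involution_blade mult_ac)
  have 2: "grade_involution (blade A * Y) = grade_involution (blade A) * grade_involution Y" for A
    by (rule linear_eq_on_blades[OF lin(1)[OF linear_times_right] lin(2)[OF linear_times_right]])
      (rule 1)
  show ?thesis
    by (rule linear_eq_on_blades[OF lin(1)[OF linear_times_left] lin(2)[OF linear_times_left]])
      (rule 2)
qed

text \<open>On basis blades, \<open>blade {i}\<close> passes \<open>blade A\<close> with the sign
  \<open>(- 1) ^ card (A - {i})\<close>, while the involution contributes
  \<open>(- 1) ^ card A\<close>. The two terms on the right thus cancel if \<open>i\<close> lies in
  \<open>A\<close> and agree otherwise.\<close>

lemma outer_of_vector_left: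
  "2 *\<^sub>R (of_vector v \<^bold>\<and> X) = of_vector v * X + grade_involution X * of_vector v"
  for X :: "'n::{finite,linorder} multivector"
proof -
  have 1: "2 *\<^sub>R (blade {i} \<^bold>\<and> blade A) =
      blade {i} * blade A + grade_involution (blade A) * blade {i}" for i and A :: "'n set"
  proof -
    \<comment> \<open>Each \<open>a\<close> other than \<open>i\<close> is out of order in exactly
      one of the two arrangements, and \<open>a = i\<close> in neither.\<close>
    have "reorder_sign {i} A * reorder_sign A {i} = (\<Prod>a\<in>A. if a = i then 1 else - 1)"
      by (auto simp: reorder_sign_def simp flip: prod.distrib intro!: prod.cong)
    also have "\<dots> = (\<Prod>a\<in>A - {i}. - 1)"
      by (rule prod.mono_neutral_cong_right) auto
    also have "\<dots> = (- 1) ^ card (A - {i})" by simp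
    finally have "reorder_sign {i} A * (reorder_sign {i} A * reorder_sign A {i}) =
        reorder_sign {i} A * (- 1) ^ card (A - {i})"
      by simp
    then have s: "reorder_sign A {i} = reorder_sign {i} A * (- 1) ^ card (A - {i})"
      using reorder_sign_square[of "{i}" A] by (simp flip: mult.assoc)
    have c: "sym_diff A {i} = sym_diff {i} A" by blast
    show ?thesis
    proof (cases "i \<in> A")
      case True
      have "card A = Suc (card (A - {i}))"
        using True by (metis card_Suc_Diff1 finite)
      then have t: "(- 1) ^ card A * reorder_sign A {i} = - reorder_sign {i} A"
        unfolding s by (simp only: power_Suc minus_one_power_iff) auto
      show ?thesis
        unfolding blade_outer blade_times grade_involution_blade mult_scaleR_left scaleR_scaleR c t
        using True by simp
    next
      case False
      then have d: "sym_diff {i} A = {i} \<union> A" and e: "A - {i} = A" by auto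
      have t: "(- 1) ^ card A * reorder_sign A {i} = reorder_sign {i} A"
        unfolding s e by (simp only: minus_one_power_iff) auto
      show ?thesis
        unfolding blade_outer blade_times grade_involution_blade mult_scaleR_left scaleR_scaleR c t d
        using False by (simp flip: scaleR_2)
    qed
  qed
  have 2: "2 *\<^sub>R (blade {i} \<^bold>\<and> X) = blade {i} * X + grade_involution X * blade {i}" for i
    by (rule linear_eq_on_blades[OF linear_compose_scale_right[OF linear_outer_right]
          linear_compose_add[OF linear_times_right linear_compose[OF linear_grade_involution
              linear_times_left, unfolded o_def]]])
      (rule 1)
  have "2 *\<^sub>R (of_vector v \<^bold>\<and> X) = (\<Sum>i\<in>UNIV. v $ i *\<^sub>R (2 *\<^sub>R (blade {i} \<^bold>\<and> X)))"
    by (simp add: of_vector_expansion linear_sum[OF linear_outer_left] scaleR_sum_right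
        linear_scale[OF linear_outer_left] mult.commute)
  also have "\<dots> = of_vector v * X + grade_involution X * of_vector v"
    by (simp add: 2 of_vector_expansion sum_distrib_left sum_distrib_right
        scaleR_right_distrib sum.distrib)
  finally show ?thesis .
qed

section \<open>Outer products of lists of vectors\<close>

lemma outer_list_Nil [simp]: "outer_list [] = 1"
  and outer_list_Cons [simp]: "outer_list (X # Xs) = X \<^bold>\<and> outer_list Xs"
  by (simp_all add: outer_list_def)

text \<open>Rewriting with \<open>outer_of_vector_left\<close> reduces this to multiplicativity for
  the geometric product.\<close>

lemma grade_involution_outer:
  "grade_involution (of_vector v \<^bold>\<and> X) = - (of_vector v \<^bold>\<and> grade_involution X)"
  for X :: "'n::{finite,linorder} multivector"
proof -
  have "2 *\<^sub>R grade_involution (of_vector v \<^bold>\<and> X) = grade_involution (2 *\<^sub>R (of_vector v \<^bold>\<and> X))"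
    by (simp add: linear_scale[OF linear_grade_involution])
  also have "\<dots> = 2 *\<^sub>R (- (of_vector v \<^bold>\<and> grade_involution X))"
    unfolding scaleR_minus_right outer_of_vector_left
    by (simp add: linear_add[OF linear_grade_involution] grade_involution_times)
  finally show ?thesis by (rule scaleR_left_imp_eq[rotated]) simp
qed

lemma grade_involution_outer_list:
  "grade_involution (outer_list (map of_vector vs)) = (- 1) ^ length vs *\<^sub>R outer_list (map of_vector vs)"
  for vs :: "(real ^ 'n::{finite,linorder}) list"
  by (induction vs) (simp_all add: grade_involution_outer linear_scale[OF linear_outer_right])

lemma outer_list_uminus:
  "outer_list (map (\<lambda>v. - of_vector v) vs) = (- 1) ^ length vs *\<^sub>R outer_list (map of_vector vs)"
  for vs :: "(real ^ 'n::{finite,linorder}) list"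
  by (induction vs)
    (simp_all add: linear_neg[OF linear_outer_left] linear_scale[OF linear_outer_right])

text \<open>A vector of the list can be moved by anticommutation until it meets its own copy, where
  the product vanishes; linearity extends this to the span.\<close>

lemma outer_of_vector_span:
  fixes vs :: "(real ^ 'n::{finite,linorder}) list"
  assumes "v \<in> span (set vs)"
  shows "of_vector v \<^bold>\<and> outer_list (map of_vector vs) = 0"
proof -
  have base: "of_vector w \<^bold>\<and> outer_list (map of_vector vs) = 0" if "w \<in> set vs" for w
    using that
  proof (induction vs)
    case (Cons u us)
    have "of_vector w \<^bold>\<and> (of_vector u \<^bold>\<and> Z) = - (of_vector u \<^bold>\<and> (of_vector w \<^bold>\<and> Z))" for Z
      using outer_of_vector_commute[of w u]
      by (simp add: linear_neg[OF linear_outer_left] flip: outer_assoc)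
    moreover have "of_vector u \<^bold>\<and> (of_vector u \<^bold>\<and> Z) = 0" for Z
      by (simp add: outer_of_vector_self linear_0[OF linear_outer_left] flip: outer_assoc)
    ultimately show ?case
      using Cons by (auto simp: linear_0[OF linear_outer_right])
  qed simp
  have lin: "linear (\<lambda>v. of_vector v \<^bold>\<and> outer_list (map of_vector vs))"
    using linear_compose[OF linear_of_vector linear_outer_left] by (simp add: o_def)
  show ?thesis
    by (rule linear_eq_0_on_span[OF lin _ assms]) (rule base)
qed

lemma of_vector_anticommute:
  "of_vector u * of_vector v = (2 * (u \<bullet> v)) *\<^sub>R 1 - of_vector v * of_vector u"
proof -
  have "(2 * (u \<bullet> v)) *\<^sub>R 1 = (u \<bullet> v) *\<^sub>R 1 + (u \<bullet> v) *\<^sub>R (1 :: 'a multivector)"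
    by (simp only: mult_2 scaleR_left_distrib)
  then show ?thesis
    unfolding of_vector_times inner_commute[of v u] outer_of_vector_commute[of v u] by simp
qed

text \<open>Orthogonal vectors anticommute, so moving \<open>b\<close> through the list costs one
  sign per vector, which the grade involution records.\<close>

lemma orthogonal_times_outer_list:
  fixes vs :: "(real ^ 'n::{finite,linorder}) list"
  assumes "\<And>v. v \<in> set vs \<Longrightarrow> b \<bullet> v = 0"
  shows "of_vector b * outer_list (map of_vector vs) =
    grade_involution (outer_list (map of_vector vs)) * of_vector b"
  using assms
proof (induction vs)
  case (Cons v vs)
  let ?X = "outer_list (map of_vector vs)" and ?Y = "grade_involution (outer_list (map of_vector vs))"
  have IH: "of_vector b * ?X = ?Y * of_vector b" using Cons by simp
  \<comment> \<open>The involuted form of the hypothesis handles the second summand of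
    \<open>outer_of_vector_left\<close>, where \<open>?Y\<close> stands on the left.\<close>
  from arg_cong[OF this, of grade_involution]
  have IH': "of_vector b * ?Y = ?X * of_vector b"
    by (simp add: grade_involution_times)
  have a: "of_vector b * of_vector v = - (of_vector v * of_vector b)"
    using of_vector_anticommute[of b v] Cons.prems by simp
  have "of_vector b * (of_vector v * ?X) = - (of_vector v * ?Y) * of_vector b"
    unfolding mult.assoc[symmetric] a by (simp add: IH mult.assoc)
  moreover have "of_vector b * (?Y * of_vector v) = - (?X * of_vector v) * of_vector b"
    unfolding mult.assoc[symmetric] IH' by (simp add: a mult.assoc)
  ultimately have "of_vector b * (2 *\<^sub>R (of_vector v \<^bold>\<and> ?X)) =
      grade_involution (2 *\<^sub>R (of_vector v \<^bold>\<and> ?X)) * of_vector b"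
    unfolding outer_of_vector_left
    by (simp add: linear_add[OF linear_grade_involution] grade_involution_times algebra_simps)
  then show ?case by (simp add: linear_scale[OF linear_grade_involution])
qed simp

text \<open>One Gram-Schmidt step: only the component \<open>b\<close> of \<open>v\<close>
  orthogonal to the remaining vectors matters. For it the outer product is the geometric product
  \<open>of_vector b * ?X\<close>, and \<open>of_vector b\<close> is invertible because its square
  is a nonzero scalar.\<close>

lemma outer_list_nonzero:
  fixes vs :: "(real ^ 'n::{finite,linorder}) list"
  assumes "distinct vs" "independent (set vs)"
  shows "outer_list (map of_vector vs) \<noteq> 0"
  using assms
proof (induction vs)
  case (Cons v vs)
  let ?X = "outer_list (map of_vector vs)"
  have v: "v \<notin> span (set vs)" and X: "?X \<noteq> 0"
    using Cons by (auto simp: independent_insert)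
  obtain a b where ab: "a \<in> span (set vs)" "\<And>w. w \<in> span (set vs) \<Longrightarrow> orthogonal b w" "v = a + b"
    using orthogonal_subspace_decomp_exists[of "set vs" v] by blast
  have "b \<noteq> 0" using ab v by auto
  have "of_vector b * ?X = grade_involution ?X * of_vector b"
    using ab(2) by (intro orthogonal_times_outer_list) (auto simp: orthogonal_def span_base)
  then have "2 *\<^sub>R (of_vector b \<^bold>\<and> ?X) = 2 *\<^sub>R (of_vector b * ?X)"
    unfolding outer_of_vector_left by (simp add: scaleR_2)
  moreover have "of_vector v \<^bold>\<and> ?X = of_vector b \<^bold>\<and> ?X"
    using outer_of_vector_span[OF ab(1)]
    by (simp add: ab(3) linear_add[OF linear_of_vector] linear_add[OF linear_outer_left])
  ultimately have "of_vector v \<^bold>\<and> ?X = of_vector b * ?X" by simp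
  moreover have "of_vector b * (of_vector b * ?X) = (b \<bullet> b) *\<^sub>R ?X"
    by (simp add: of_vector_square flip: mult.assoc)
  ultimately show ?case
    using X \<open>b \<noteq> 0\<close> by auto
qed simp

section \<open>Reflections in an inner product space\<close>

definition reflection :: "'a::real_inner \<Rightarrow> 'a \<Rightarrow> 'a" where
  "reflection u v = v - (2 * (u \<bullet> v)) *\<^sub>R u"

lemma inner_reflection:
  assumes "norm u = 1"
  shows "reflection u v \<bullet> reflection u w = v \<bullet> w"
proof -
  have "u \<bullet> u = 1" using assms by (simp add: norm_eq_1)
  then show ?thesis
    by (simp add: reflection_def inner_diff_left inner_diff_right inner_commute[of v u] algebra_simps)
qed

lemma reflection_orthogonal: "u \<bullet> v = 0 \<Longrightarrow> reflection u v = v"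
  by (simp add: reflection_def)

text \<open>Equal norms make \<open>v + w\<close> orthogonal to \<open>v - w\<close>, so the
  reflection fixes the midpoint of \<open>v\<close> and \<open>w\<close> and exchanges the
  two.\<close>

lemma reflection_difference:
  assumes "norm v = norm w" "v \<noteq> w"
  shows "reflection ((v - w) /\<^sub>R norm (v - w)) v = w"
proof -
  have n: "(norm (v - w))\<^sup>2 = 2 * ((v - w) \<bullet> v)"
    using assms(1) unfolding power2_norm_eq_inner
    by (simp add: norm_eq inner_diff_left inner_diff_right inner_commute[of w v])
  have "(2 * (((v - w) /\<^sub>R norm (v - w)) \<bullet> v)) *\<^sub>R ((v - w) /\<^sub>R norm (v - w))
      = (2 * ((v - w) \<bullet> v) / (norm (v - w))\<^sup>2) *\<^sub>R (v - w)"
    by (simp add: power2_eq_square divide_inverse mult_ac)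
  also have "\<dots> = v - w"
    using assms(2) by (simp flip: n)
  finally show ?thesis by (simp add: reflection_def)
qed

section \<open>Conjugation by products of unit vectors\<close>

lemma sandwich_unit_vector:
  fixes u v :: "real ^ 'n::{finite,linorder}"
  assumes "norm u = 1"
  shows "of_vector u * of_vector v * of_vector u = - of_vector (reflection u v)"
proof -
  have "of_vector u * of_vector u = 1"
    using assms by (simp add: of_vector_square norm_eq_1)
  then show ?thesis
    by (simp add: of_vector_anticommute[of u v] reflection_def left_diff_distrib mult.assoc
        linear_diff[OF linear_of_vector] linear_scale[OF linear_of_vector])
qed

text \<open>Each unit vector contributes a reflection and a factor -1. The last one is innermost and
  acts first, matching the order of \<open>foldr\<close>.\<close>

lemma sandwich_unit_vectors:
  fixes us :: "(real ^ 'n::{finite,linorder}) list"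
  assumes "\<forall>u\<in>set us. norm u = 1"
  defines "P \<equiv> prod_list (map of_vector us)"
  shows "P * of_vector v * reversal P = (- 1) ^ length us *\<^sub>R of_vector (foldr reflection us v)"
  using assms(1) unfolding P_def
proof (induction us)
  case (Cons u us)
  let ?P = "prod_list (map of_vector us)"
  have "of_vector u * ?P * of_vector v * reversal (of_vector u * ?P) =
      of_vector u * (?P * of_vector v * reversal ?P) * of_vector u"
    by (simp add: reversal_times mult.assoc)
  also have "\<dots> = (- 1) ^ length us *\<^sub>R
      (of_vector u * of_vector (foldr reflection us v) * of_vector u)"
    using Cons by simp
  finally show ?case
    using Cons.prems by (simp add: sandwich_unit_vector)
qed simp

lemma unit_vectors_reversal:
  fixes us :: "(real ^ 'n::{finite,linorder}) list"
  assumes "\<forall>u\<in>set us. norm u = 1"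
  defines "P \<equiv> prod_list (map of_vector us)"
  shows "P * reversal P = 1" "reversal P * P = 1"
proof -
  have *: "prod_list (map of_vector vs) * prod_list (map of_vector (rev vs)) = 1"
    if "\<forall>u\<in>set vs. norm u = 1" for vs :: "(real ^ 'n::{finite,linorder}) list"
    using that
  proof (induction vs)
    case (Cons u us)
    have "of_vector u * of_vector u = 1"
      using Cons.prems by (simp add: of_vector_square norm_eq_1)
    moreover have "of_vector u * prod_list (map of_vector us) *
        (prod_list (map of_vector (rev us)) * of_vector u) = of_vector u *
        (prod_list (map of_vector us) * prod_list (map of_vector (rev us))) * of_vector u"
      by (simp only: mult.assoc)
    ultimately show ?case
      using Cons by simp
  qed simp
  show "P * reversal P = 1" "reversal P * P = 1"
    using *[of us] *[of "rev us"] assms(1) by (simp_all add: P_def reversal_prod_list)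
qed

lemma grade_involution_prod_list:
  "grade_involution (prod_list (map of_vector us)) = (- 1) ^ length us *\<^sub>R prod_list (map of_vector us)"
  for us :: "(real ^ 'n::{finite,linorder}) list"
  by (induction us) (simp_all add: grade_involution_times)

text \<open>Conjugation by \<open>P\<close> respects the geometric product, and it commutes with the
  grade involution because the equal signs of \<open>P\<close> and its reversal cancel. By
  \<open>outer_of_vector_left\<close> it then respects outer products with a vector.\<close>

lemma sandwich_outer_list:
  fixes us vs :: "(real ^ 'n::{finite,linorder}) list"
  assumes "\<forall>u\<in>set us. norm u = 1"
  defines "P \<equiv> prod_list (map of_vector us)"
  shows "P * outer_list (map of_vector vs) * reversal P =
    outer_list (map (\<lambda>v. P * of_vector v * reversal P) vs)"
proof (induction vs)
  case Nil
  then show ?case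
    using unit_vectors_reversal[OF assms(1)] by (simp add: P_def)
next
  case (Cons v vs)
  let ?X = "outer_list (map of_vector vs)" and ?Q = "reversal P"
  \<comment> \<open>Naming the conjugate as a vector allows \<open>outer_of_vector_left\<close> to
    be applied to it as well.\<close>
  define w where "w = (- 1) ^ length us *\<^sub>R foldr reflection us v"
  have w: "P * of_vector v * ?Q = of_vector w"
    using sandwich_unit_vectors[OF assms(1)]
    by (simp add: P_def w_def linear_scale[OF linear_of_vector])
  have "?Q * P = 1"
    using unit_vectors_reversal[OF assms(1)] by (simp add: P_def)
  then have m: "P * Y * ?Q * (P * Z * ?Q) = P * (Y * Z) * ?Q" for Y Z
    by (metis mult.assoc mult_1)
  have "grade_involution ?Q = (- 1) ^ length us *\<^sub>R ?Q"
    using grade_involution_prod_list[of "rev us"] by (simp add: P_def reversal_prod_list)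
  then have g: "grade_involution (P * Y * ?Q) = P * grade_involution Y * ?Q" for Y
    by (simp add: grade_involution_times grade_involution_prod_list[of us, folded P_def]
        flip: power_add)
  have "2 *\<^sub>R (P * (of_vector v \<^bold>\<and> ?X) * ?Q) = P * (2 *\<^sub>R (of_vector v \<^bold>\<and> ?X)) * ?Q"
    by simp
  also have "\<dots> = 2 *\<^sub>R (of_vector w \<^bold>\<and> (P * ?X * ?Q))"
    unfolding outer_of_vector_left g by (simp only: distrib_left distrib_right m flip: w)
  finally show ?case
    using Cons w by simp
qed

text \<open>Since \<open>vs\<close> spans, every vector has outer product zero with
  \<open>X\<close>; hence it commutes with \<open>X\<close> up to a fixed sign, collected once per
  factor of \<open>P\<close>.\<close>

lemma unit_vectors_times_pseudoscalar:
  fixes us vs :: "(real ^ 'n::{finite,linorder}) list"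
  assumes "span (set vs) = UNIV"
  defines "P \<equiv> prod_list (map of_vector us)" and "X \<equiv> outer_list (map of_vector vs)"
  shows "P * X = ((- 1) ^ Suc (length vs)) ^ length us *\<^sub>R (X * P)"
proof -
  have v: "of_vector v * X = (- 1) ^ Suc (length vs) *\<^sub>R (X * of_vector v)" for v
    using outer_of_vector_left[of v X] outer_of_vector_span[of v vs] assms(1)
    by (simp add: X_def grade_involution_outer_list eq_neg_iff_add_eq_0)
  show ?thesis
    unfolding P_def
  proof (induction us)
    case (Cons u us)
    let ?P = "prod_list (map of_vector us)" and ?c = "(- 1) ^ Suc (length vs) :: real"
    have "of_vector u * ?P * X = ?c ^ length us *\<^sub>R (of_vector u * X * ?P)"
      by (simp add: Cons mult.assoc)
    also have "\<dots> = ?c ^ Suc (length us) *\<^sub>R (X * (of_vector u * ?P))"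
      unfolding v by (simp add: mult.assoc mult.commute)
    finally show ?case by simp
  qed simp
qed

section \<open>Matching the two families by reflections, and the parity of their number\<close>

lemma reflections_matching_gram:
  fixes x y :: "nat \<Rightarrow> 'a::real_inner"
  assumes "\<And>i j. i \<in> {1..n} \<Longrightarrow> j \<in> {1..n} \<Longrightarrow> x i \<bullet> x j = y i \<bullet> y j"
  shows "\<exists>us. (\<forall>u\<in>set us. norm u = 1) \<and> (\<forall>i\<in>{1..n}. foldr reflection us (x i) = y i)"
  using assms
proof (induction n)
  case (Suc n)
  then obtain us where us: "\<forall>u\<in>set us. norm u = 1"
      "\<And>i. i \<in> {1..n} \<Longrightarrow> foldr reflection us (x i) = y i"
    by fastforce
  have iso: "foldr reflection us v \<bullet> foldr reflection us w = v \<bullet> w" for v w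
    using us(1) by (induction us) (auto simp: inner_reflection)
  define z where "z = foldr reflection us (x (Suc n))"
  show ?case
  \<comment> \<open>If the new image is already correct, the difference vanishes and cannot be
    normalised; no reflection is added.\<close>
  proof (cases "z = y (Suc n)")
    case True
    then have "\<forall>i\<in>{1..Suc n}. foldr reflection us (x i) = y i"
      using us(2) by (auto simp: z_def le_Suc_eq)
    then show ?thesis using us(1) by blast
  next
    case False
    define u where "u = (z - y (Suc n)) /\<^sub>R norm (z - y (Suc n))"
    have "norm z = norm (y (Suc n))"
      using Suc.prems[of "Suc n" "Suc n"] by (simp add: norm_eq z_def iso)
    then have "reflection u z = y (Suc n)"
      using False unfolding u_def by (rule reflection_difference)
    moreover have "reflection u (y i) = y i" if "i \<in> {1..n}" for i
    proof (rule reflection_orthogonal)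
      \<comment> \<open>Both \<open>z\<close> and \<open>y i\<close> are images under the isometry
        built so far, so their inner product is that of \<open>x (Suc n)\<close> and
        \<open>x i\<close>.\<close>
      have "z \<bullet> y i = y (Suc n) \<bullet> y i"
        using Suc.prems[of "Suc n" i] that unfolding z_def by (simp add: iso flip: us(2)[OF that])
      then show "u \<bullet> y i = 0" by (simp add: u_def inner_diff_left)
    qed
    \<comment> \<open>Prepending \<open>u\<close> makes its reflection act last, on the images
      already obtained.\<close>
    ultimately have "\<forall>i\<in>{1..Suc n}. foldr reflection (u # us) (x i) = y i"
      using us(2) by (auto simp: z_def le_Suc_eq)
    moreover have "norm u = 1" using False by (simp add: u_def)
    ultimately show ?thesis using us(1) by (metis set_ConsD)
  qed
qed (rule exI[of _ "[]"], simp)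

theorem theorem3p6:
  fixes x y :: "nat \<Rightarrow> real ^ 'n::{finite,linorder}"
  assumes "is_basis x" and "is_basis y"
    and "\<And>i j. i \<in> {1..CARD('n)} \<Longrightarrow> j \<in> {1..CARD('n)} \<Longrightarrow> x i \<bullet> x j = y i \<bullet> y j"
    and "outer_list (map (\<lambda>i. of_vector (x i)) [1..<Suc CARD('n)]) =
         outer_list (map (\<lambda>i. of_vector (y i)) [1..<Suc CARD('n)])"
  shows "\<exists>R :: 'n multivector. rotor R \<and>
           (\<forall>i\<in>{1..CARD('n)}. R * of_vector (x i) * reversal R = of_vector (y i))"
proof -
  obtain us where us: "\<forall>u\<in>set us. norm u = 1"
      "\<And>i. i \<in> {1..CARD('n)} \<Longrightarrow> foldr reflection us (x i) = y i"
    using reflections_matching_gram[of "CARD('n)" x y] assms(3) by blast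
  define P :: "'n multivector" where "P = prod_list (map of_vector us)"
  have P: "P * of_vector (x i) * reversal P = (- 1) ^ length us *\<^sub>R of_vector (y i)"
    if "i \<in> {1..CARD('n)}" for i
    using sandwich_unit_vectors[OF us(1), of "x i"] us(2)[OF that] by (simp add: P_def)
  have "even (length us)"
  proof (rule ccontr)
    assume odd: "odd (length us)"
    define xs where "xs = map x [1..<Suc CARD('n)]"
    define ys where "ys = map y [1..<Suc CARD('n)]"
    define X where "X = outer_list (map of_vector xs)"
    have set: "set [1..<Suc CARD('n)] = {1..CARD('n)}" by auto
    have len: "length xs = CARD('n)" "length ys = CARD('n)" by (simp_all add: xs_def ys_def)
    have "distinct xs" "independent (set xs)" "span (set xs) = UNIV"
      using assms(1) by (simp_all only: is_basis_def xs_def set_map distinct_map set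
          distinct_upt DIM_cart DIM_real mult_1_right simp_thms)
    then have "X \<noteq> 0" unfolding X_def by (intro outer_list_nonzero)
    have "map (\<lambda>v. P * of_vector v * reversal P) xs = map (\<lambda>v. - of_vector v) ys"
      unfolding xs_def ys_def map_map using P odd
      by (intro map_cong refl) (simp only: set o_apply, simp)
    then have "P * X * reversal P = (- 1) ^ CARD('n) *\<^sub>R outer_list (map of_vector ys)"
      using sandwich_outer_list[OF us(1), of xs]
      by (simp add: P_def X_def outer_list_uminus len)
    \<comment> \<open>The assumed equality of the outer products, that is of orientation, enters
      here.\<close>
    also have "outer_list (map of_vector ys) = X"
      using assms(4) by (simp only: X_def xs_def ys_def map_map o_def)
    finally have 1: "P * X * reversal P = (- 1) ^ CARD('n) *\<^sub>R X" .
    \<comment> \<open>An odd power of a sign is the sign itself, so this exponent differs by one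
      from that in the conjugation formula above.\<close>
    have "P * X = (- 1) ^ Suc CARD('n) *\<^sub>R (X * P)"
      using unit_vectors_times_pseudoscalar[OF \<open>span (set xs) = UNIV\<close>, of us] odd
      by (simp add: P_def X_def len minus_one_power_iff)
    then have "P * X * reversal P = (- 1) ^ Suc CARD('n) *\<^sub>R X"
      using unit_vectors_reversal(1)[OF us(1)] by (simp add: P_def mult.assoc)
    with 1 have "X = - X"
      by (auto simp: minus_one_power_iff split: if_splits)
    then have "2 *\<^sub>R X = 0"
      unfolding scaleR_2 by (simp only: eq_neg_iff_add_eq_0)
    then show False using \<open>X \<noteq> 0\<close> by simp
  qed
  then have "rotor P" using us(1) by (auto simp: rotor_def P_def)
  then show ?thesis using P \<open>even (length us)\<close> by auto
qed

end
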